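(* Let $n\ge1$, let $\lambda_1\ge\dots\ge\lambda_n>0$ be real numbers, and let $x^0\in\mathbb{R}^n$ with $x^0_i>0$ for all $i$. Let $f(\mu)=\sum_{i=1}^n\lambda_i\left(\frac{x^0_i}{1+\mu\lambda_i}\right)^2-1$ and $\mathcal I=\,]-\frac1{\lambda_1},+\infty[$. Let $\mu^0\in\mathcal I$ with $f(\mu^0)>0$. Then the Newton–Raphson algorithm with starting point $\mu^0$, i.e. the sequence $\mu^{k+1}=\mu^k-\frac{f(\mu^k)}{f'(\mu^k)}$, $k=0,1,\dots$, converges to $\mu^*$, the unique root of $f$ on $\mathcal I$. *)

theory Defs
  imports "HOL-Analysis.Analysis"
begin

text \<open>The vectors \<open>\<lambda>, x\<^sup>0 \<in> \<real>\<^sup>n\<close> are functions on \<open>nat\<close> of which only the values at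
  \<open>1, \<dots>, n\<close> matter.\<close>

definition secular :: "nat \<Rightarrow> (nat \<Rightarrow> real) \<Rightarrow> (nat \<Rightarrow> real) \<Rightarrow> real \<Rightarrow> real" where
  "secular n lam x0 \<mu> = (\<Sum>i=1..n. lam i * (x0 i / (1 + \<mu> * lam i))\<^sup>2) - 1"

definition secular_dom :: "(nat \<Rightarrow> real) \<Rightarrow> real set" where
  "secular_dom lam = {- 1 / lam 1 <..}"

text \<open>Division is total, so this is also defined when \<open>deriv f\<close> vanishes at an iterate (the
  sequence then stalls there), and \<open>deriv f\<close> is unspecified where \<open>f\<close> is not differentiable.
  Hence well-definedness of the sequence needs to be stated separately.\<close>

primrec newton_raphson :: "(real \<Rightarrow> real) \<Rightarrow> real \<Rightarrow> nat \<Rightarrow> real" where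
  "newton_raphson f \<mu>0 0 = \<mu>0"
| "newton_raphson f \<mu>0 (Suc k) =
     newton_raphson f \<mu>0 k - f (newton_raphson f \<mu>0 k) / deriv f (newton_raphson f \<mu>0 k)"

definition newton_raphson_well_defined_on :: "real set \<Rightarrow> (real \<Rightarrow> real) \<Rightarrow> real \<Rightarrow> bool" where
  "newton_raphson_well_defined_on S f \<mu>0 \<longleftrightarrow>
     (\<forall>k. newton_raphson f \<mu>0 k \<in> S \<and>
          f differentiable (at (newton_raphson f \<mu>0 k)) \<and>
          deriv f (newton_raphson f \<mu>0 k) \<noteq> 0)"

end

theory Submission
  imports Defs
begin

text \<open>On \<open>\<I> = {-1 / \<lambda>\<^sub>1 <..}\<close> all the denominators \<open>1 + \<mu> \<lambda>\<^sub>i\<close> are positive, so the function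
  \<open>f\<close> is convex there with strictly negative derivative: each summand is a positive multiple of
  \<open>(1 + \<mu> \<lambda>\<^sub>i)\<^sup>-\<^sup>2\<close>. It is positive at the starting point and tends to \<open>-1\<close> at infinity, hence
  it has a root \<open>\<mu>\<^sup>*\<close>.

  Everything else holds for any convex function that decreases through a root (lemma
  \<open>newton_raphson_convex_decreasing\<close>). The graph lies above each of its tangents, and a Newton
  step goes to the zero of a tangent. So an iterate with \<open>f \<ge> 0\<close>, which lies to the left of
  the root, is moved to the right without passing the root, and \<open>f \<ge> 0\<close> still holds at the new
  point. The iterates therefore increase and never exceed \<open>\<mu>\<^sup>*\<close>. They converge, and their limit
  must be a root because the steps tend to zero while the slopes stay bounded.\<close>

section \<open>Newton's method for convex decreasing functions\<close>

text \<open>The tangent at a root \<open>t\<close> has negative slope, so it is positive, and \<open>f\<close> with it, at every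
  point to the left of \<open>t\<close>.\<close>

lemma convex_decreasing_root_unique:
  fixes f f' :: "real \<Rightarrow> real"
  assumes "open S" and "convex_on S f"
    and deriv: "\<And>x. x \<in> S \<Longrightarrow> (f has_real_derivative f' x) (at x)"
    and neg: "\<And>x. x \<in> S \<Longrightarrow> f' x < 0"
    and "s \<in> S" "f s = 0" "t \<in> S" "f t = 0"
  shows "s = t"
proof -
  have conn: "connected S"
    using assms(2) by (auto simp: convex_on_def intro: convex_connected)
  have no_root_left: False if "x \<in> S" "f x = 0" "y \<in> S" "f y = 0" "y < x" for x y
  proof -
    have "f' x * (y - x) \<le> f y - f x"
      using convex_on_imp_above_tangent[OF assms(2) conn _ that(3)] \<open>x \<in> S\<close> \<open>open S\<close>
        has_field_derivative_at_within[OF deriv[OF \<open>x \<in> S\<close>]]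
      by (simp add: interior_open)
    moreover have "f' x * (y - x) > 0"
      using neg[OF that(1)] that(5) by (simp add: mult_neg_neg)
    ultimately show False using that by simp
  qed
  show ?thesis
    using no_root_left[of s t] no_root_left[of t s] assms by (cases s t rule: linorder_cases) auto
qed

text \<open>The hypothesis \<open>f x0 \<ge> 0\<close> places the start to the left of the root. From the right, the
  first step could overshoot so far to the left that it leaves \<open>S\<close>.\<close>

lemma newton_raphson_convex_decreasing:
  fixes f f' :: "real \<Rightarrow> real"
  assumes "open S" and "convex_on S f"
    and deriv: "\<And>x. x \<in> S \<Longrightarrow> (f has_real_derivative f' x) (at x)"
    and neg: "\<And>x. x \<in> S \<Longrightarrow> f' x < 0"
    and root: "s \<in> S" "f s = 0"
    and start: "x0 \<in> S" "f x0 \<ge> 0"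
  shows "newton_raphson_well_defined_on S f x0" and "newton_raphson f x0 \<longlonglongrightarrow> s"
proof -
  define x where "x = newton_raphson f x0"
  have conv: "convex S"
    using assms(2) by (simp add: convex_on_def)
  have tangent: "f' u * (v - u) \<le> f v - f u" if "u \<in> S" "v \<in> S" for u v
    using convex_on_imp_above_tangent[OF assms(2) convex_connected[OF conv] _ that(2)]
      has_field_derivative_at_within[OF deriv[OF that(1)]] that(1) \<open>open S\<close>
    by (simp add: interior_open)
  have step: "x (Suc k) = x k - f (x k) / f' (x k)" if "x k \<in> S" for k
    using DERIV_imp_deriv[OF deriv[OF that]] by (simp add: x_def)
  have between: "v \<in> S" if "u \<in> S" "u \<le> v" "v \<le> s" for u v
    using closed_segment_subset[OF that(1) root(1) conv] that(2,3)
    by (auto simp: closed_segment_eq_real_ivl)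

  \<comment> \<open>The tangent at \<open>u\<close>, evaluated at \<open>s\<close>, bounds its own zero by \<open>s\<close>; evaluated at its zero,
    it shows that \<open>f\<close> is nonnegative there.\<close>
  have move: "u \<le> v \<and> v \<le> s \<and> v \<in> S \<and> f v \<ge> 0"
    if u: "u \<in> S" "f u \<ge> 0" and v: "v = u - f u / f' u" for u v
  proof -
    have f'u: "f' u < 0" using neg u(1) .
    have zero: "f' u * (v - u) = - f u"
      using f'u v by simp
    have "u \<le> v" using u(2) f'u v by (simp add: divide_nonneg_neg)
    moreover have "v \<le> s"
    proof -
      have "f' u * (s - u) \<le> f' u * (v - u)"
        using tangent[OF u(1) root(1)] root(2) zero by simp
      thus ?thesis using f'u by (simp add: mult_le_cancel_left)
    qed
    moreover have "v \<in> S" using between u(1) calculation by blast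
    moreover have "f v \<ge> 0" using tangent[OF u(1) \<open>v \<in> S\<close>] zero by simp
    ultimately show ?thesis by blast
  qed
  have inv: "x k \<in> S \<and> f (x k) \<ge> 0" for k
  proof (induction k)
    case 0
    show ?case using start by (simp add: x_def)
  next
    case (Suc k)
    thus ?case using move step by blast
  qed
  have inc: "x k \<le> x (Suc k)" and bound: "x (Suc k) \<le> s" for k
    using move[of "x k" "x (Suc k)"] inv[of k] step[of k] by blast+

  show "newton_raphson_well_defined_on S f x0"
    unfolding newton_raphson_well_defined_on_def
  proof (intro allI conjI)
    fix k
    have "x k \<in> S" using inv by blast
    note d = deriv[OF this]
    show "newton_raphson f x0 k \<in> S"
      using \<open>x k \<in> S\<close> by (simp add: x_def)
    show "f differentiable (at (newton_raphson f x0 k))"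
      using d by (auto simp: x_def real_differentiable_def)
    show "deriv f (newton_raphson f x0 k) \<noteq> 0"
      using DERIV_imp_deriv[OF d] neg[OF \<open>x k \<in> S\<close>] by (simp add: x_def)
  qed

  have "incseq x" using inc by (rule incseq_SucI)
  moreover have "x k \<le> s" for k using inc[of k] bound[of k] by simp
  ultimately obtain l where lim: "x \<longlonglongrightarrow> l" and below: "\<And>k. x k \<le> l"
    using incseq_convergent[of x s] by blast
  have "l \<le> s" using LIMSEQ_le_const2[OF lim] \<open>\<And>k. x k \<le> s\<close> by blast
  hence "l \<in> S" using between[of "x 0" l] inv below by blast

  \<comment> \<open>Two opposite tangent inequalities make the slopes monotone, so all slopes along the
    sequence are bounded by the one at \<open>x 0\<close>.\<close>
  have slope: "f' (x 0) \<le> f' (x k)" for k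
  proof (cases "x 0 = x k")
    case False
    hence lt: "x 0 < x k" using incseqD[OF \<open>incseq x\<close>, of 0 k] by simp
    have "f' (x 0) * (x k - x 0) \<le> f' (x k) * (x k - x 0)"
      using tangent[of "x 0" "x k"] tangent[of "x k" "x 0"] inv by (auto simp: algebra_simps)
    thus ?thesis using lt by simp
  qed simp
  have upper: "f (x k) \<le> - f' (x 0) * (x (Suc k) - x k)" for k
  proof -
    have "x k \<in> S" using inv by blast
    hence "f (x k) = - f' (x k) * (x (Suc k) - x k)"
      using neg[of "x k"] by (simp add: step)
    also have "\<dots> \<le> - f' (x 0) * (x (Suc k) - x k)"
      using slope inc by (intro mult_right_mono) auto
    finally show ?thesis .
  qed
  have "(\<lambda>k. - f' (x 0) * (x (Suc k) - x k)) \<longlonglongrightarrow> - f' (x 0) * (l - l)"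
    using lim by (intro tendsto_intros LIMSEQ_Suc)
  hence upper_lim: "(\<lambda>k. - f' (x 0) * (x (Suc k) - x k)) \<longlonglongrightarrow> 0" by simp
  have "(\<lambda>k. f (x k)) \<longlonglongrightarrow> 0"
    by (rule tendsto_sandwich[OF _ _ tendsto_const upper_lim])
      (use inv upper in \<open>blast intro: always_eventually\<close>)+
  moreover have "(\<lambda>k. f (x k)) \<longlonglongrightarrow> f l"
    using isCont_tendsto_compose[OF DERIV_isCont[OF deriv[OF \<open>l \<in> S\<close>]] lim] .
  ultimately have "f l = 0" by (rule LIMSEQ_unique[symmetric])
  hence "l = s"
    using convex_decreasing_root_unique[OF assms(1-4)] \<open>l \<in> S\<close> root by blast
  with lim show "newton_raphson f x0 \<longlonglongrightarrow> s" by (simp add: x_def)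
qed

section \<open>The secular function\<close>

text \<open>For negative \<open>\<mu>\<close> the largest weight gives the smallest denominator, and that one is
  positive by the choice of the domain.\<close>

lemma secular_dom_denominator_pos:
  assumes "0 < lam i" "lam i \<le> lam 1" "\<mu> \<in> secular_dom lam"
  shows "0 < 1 + \<mu> * lam i"
proof (cases "\<mu> \<ge> 0")
  case True
  thus ?thesis using assms(1) by (simp add: add_pos_nonneg)
next
  case False
  have "\<mu> * lam 1 > -1"
    using assms pos_divide_less_eq[of "lam 1" "-1" \<mu>] by (simp add: secular_dom_def)
  moreover have "\<mu> * lam 1 \<le> \<mu> * lam i"
    using False assms(2) by (intro mult_left_mono_neg) auto
  ultimately show ?thesis by simp
qed

lemma secular_summand_has_derivative:
  fixes l c \<mu> :: real
  assumes "0 < 1 + \<mu> * l"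
  shows "((\<lambda>\<mu>. l * (c / (1 + \<mu> * l))\<^sup>2) has_real_derivative
    - 2 * l\<^sup>2 * c\<^sup>2 / (1 + \<mu> * l) ^ 3) (at \<mu>)"
proof -
  have "((\<lambda>\<mu>. l * (c / (1 + \<mu> * l))\<^sup>2) has_real_derivative
    l * (2 * (c / (1 + \<mu> * l)) * (- (c * l) / ((1 + \<mu> * l) * (1 + \<mu> * l))))) (at \<mu>)"
    using assms by (auto intro!: derivative_eq_intros simp: mult_ac)
  also have "l * (2 * (c / (1 + \<mu> * l)) * (- (c * l) / ((1 + \<mu> * l) * (1 + \<mu> * l))))
      = - 2 * l\<^sup>2 * c\<^sup>2 / (1 + \<mu> * l) ^ 3"
    by (simp add: power2_eq_square power3_eq_cube mult_ac)
  finally show ?thesis .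
qed

lemma secular_summand_convex:
  fixes l c :: real
  assumes "0 < l" "convex S" and pos: "\<And>\<mu>. \<mu> \<in> S \<Longrightarrow> 0 < 1 + \<mu> * l"
  shows "convex_on S (\<lambda>\<mu>. l * (c / (1 + \<mu> * l))\<^sup>2)"
proof (rule f''_ge0_imp_convex[OF \<open>convex S\<close>])
  fix \<mu> assume "\<mu> \<in> S"
  note p = pos[OF this]
  show "((\<lambda>\<mu>. l * (c / (1 + \<mu> * l))\<^sup>2) has_real_derivative
    - 2 * l\<^sup>2 * c\<^sup>2 / (1 + \<mu> * l) ^ 3) (at \<mu>)"
    using p by (rule secular_summand_has_derivative)
  have "((\<lambda>\<mu>. - 2 * l\<^sup>2 * c\<^sup>2 / (1 + \<mu> * l) ^ 3) has_real_derivative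
    2 * l\<^sup>2 * c\<^sup>2 * (3 * (1 + \<mu> * l)\<^sup>2 * l) / ((1 + \<mu> * l) ^ 3 * (1 + \<mu> * l) ^ 3))
    (at \<mu>)"
    using p by (auto intro!: derivative_eq_intros)
  also have "2 * l\<^sup>2 * c\<^sup>2 * (3 * (1 + \<mu> * l)\<^sup>2 * l) / ((1 + \<mu> * l) ^ 3 * (1 + \<mu> * l) ^ 3)
      = 6 * l ^ 3 * c\<^sup>2 / (1 + \<mu> * l) ^ 4"
  proof -
    have "2 * l\<^sup>2 * c\<^sup>2 * (3 * a\<^sup>2 * l) / (a ^ 3 * a ^ 3) = 6 * l ^ 3 * c\<^sup>2 / a ^ 4"
      if "a > 0" for a :: real
      using that by (simp add: field_simps eval_nat_numeral)
    thus ?thesis using p by blast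
  qed
  finally show "((\<lambda>\<mu>. - 2 * l\<^sup>2 * c\<^sup>2 / (1 + \<mu> * l) ^ 3) has_real_derivative
    6 * l ^ 3 * c\<^sup>2 / (1 + \<mu> * l) ^ 4) (at \<mu>)" .
  show "6 * l ^ 3 * c\<^sup>2 / (1 + \<mu> * l) ^ 4 \<ge> 0"
    using p \<open>0 < l\<close> by simp
qed

lemma secular_tendsto_at_top:
  assumes "\<And>i. i \<in> {1..n} \<Longrightarrow> lam i > 0"
  shows "(secular n lam x0 \<longlongrightarrow> - 1) at_top"
proof -
  have "((\<lambda>\<mu>. lam i * (x0 i / (1 + \<mu> * lam i))\<^sup>2) \<longlongrightarrow> lam i * 0\<^sup>2) at_top" if "i \<in> {1..n}" for i
  proof -
    have "filterlim (\<lambda>\<mu>. 1 + \<mu> * lam i) at_top at_top"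
      using assms[OF that]
      by (intro filterlim_tendsto_add_at_top[OF tendsto_const]
          filterlim_at_top_mult_tendsto_pos[OF tendsto_const] filterlim_ident)
    hence "((\<lambda>\<mu>. x0 i / (1 + \<mu> * lam i)) \<longlongrightarrow> 0) at_top"
      by (intro tendsto_divide_0[OF tendsto_const] filterlim_at_top_imp_at_infinity)
    thus ?thesis by (rule tendsto_mult[OF tendsto_const tendsto_power])
  qed
  hence "((\<lambda>\<mu>. (\<Sum>i=1..n. lam i * (x0 i / (1 + \<mu> * lam i))\<^sup>2) - 1)
      \<longlongrightarrow> (\<Sum>i=1..n. lam i * 0\<^sup>2) - 1) at_top"
    by (intro tendsto_diff tendsto_sum tendsto_const)
  thus ?thesis by (simp add: secular_def[abs_def])
qed

theorem proposition2p8: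
  fixes n :: nat and lam x0 :: "nat \<Rightarrow> real" and \<mu>0 :: real
  assumes "n \<ge> 1"
    and "\<And>i j. 1 \<le> i \<Longrightarrow> i \<le> j \<Longrightarrow> j \<le> n \<Longrightarrow> lam j \<le> lam i"
    and "lam n > 0"
    and "\<And>i. 1 \<le> i \<Longrightarrow> i \<le> n \<Longrightarrow> x0 i > 0"
    and "\<mu>0 \<in> secular_dom lam"
    and "secular n lam x0 \<mu>0 > 0"
  shows "newton_raphson_well_defined_on (secular_dom lam) (secular n lam x0) \<mu>0 \<and>
    (\<exists>\<mu>s. \<mu>s \<in> secular_dom lam \<and> secular n lam x0 \<mu>s = 0 \<and>
          (\<forall>\<mu>\<in>secular_dom lam. secular n lam x0 \<mu> = 0 \<longrightarrow> \<mu> = \<mu>s) \<and>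
          newton_raphson (secular n lam x0) \<mu>0 \<longlonglongrightarrow> \<mu>s)"
proof -
  define S where "S = secular_dom lam"
  define f where "f = secular n lam x0"
  define f' where "f' \<mu> = (\<Sum>i=1..n. - 2 * (lam i)\<^sup>2 * (x0 i)\<^sup>2 / (1 + \<mu> * lam i) ^ 3)" for \<mu>
  have S: "open S" "convex S"
    by (auto simp: S_def secular_dom_def)
  have lam_pos: "lam i > 0" if "i \<in> {1..n}" for i
    using assms(2)[of i n] assms(3) that by simp
  have denom: "0 < 1 + \<mu> * lam i" if "\<mu> \<in> S" "i \<in> {1..n}" for \<mu> i
    using secular_dom_denominator_pos[of lam i \<mu>] lam_pos that assms(2)[of 1 i]
    by (simp add: S_def)
  have deriv: "(f has_real_derivative f' \<mu>) (at \<mu>)" if "\<mu> \<in> S" for \<mu>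
  proof -
    have "((\<lambda>\<mu>. (\<Sum>i=1..n. lam i * (x0 i / (1 + \<mu> * lam i))\<^sup>2) - 1) has_real_derivative f' \<mu> - 0)
        (at \<mu>)"
      unfolding f'_def using denom[OF that]
      by (intro DERIV_diff DERIV_sum DERIV_const secular_summand_has_derivative)
    thus ?thesis by (simp add: f_def secular_def[abs_def])
  qed
  have neg: "f' \<mu> < 0" if "\<mu> \<in> S" for \<mu>
  proof -
    have "0 < (\<Sum>i=1..n. 2 * (lam i)\<^sup>2 * (x0 i)\<^sup>2 / (1 + \<mu> * lam i) ^ 3)"
    proof (rule sum_pos)
      fix i assume i: "i \<in> {1..n}"
      show "0 < 2 * (lam i)\<^sup>2 * (x0 i)\<^sup>2 / (1 + \<mu> * lam i) ^ 3"
        using lam_pos[OF i] denom[OF that i] assms(4)[of i] i by simp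
    qed (use assms(1) in auto)
    thus ?thesis by (simp add: f'_def sum_negf)
  qed
  have conv: "convex_on S f"
  proof -
    have "convex_on S (\<lambda>\<mu>. \<Sum>i\<in>I. lam i * (x0 i / (1 + \<mu> * lam i))\<^sup>2)"
      if "finite I" "I \<subseteq> {1..n}" for I
      using that
    proof (induction I rule: finite_induct)
      case empty
      show ?case using S(2) by (simp add: convex_on_const)
    next
      case (insert i I)
      thus ?case
        using convex_on_add[OF secular_summand_convex[OF lam_pos S(2) denom]] by simp
    qed
    from this[of "{1..n}"]
    have "convex_on S (\<lambda>\<mu>. (\<Sum>i=1..n. lam i * (x0 i / (1 + \<mu> * lam i))\<^sup>2) + - 1)"
      using S(2) by (intro convex_on_add) (simp_all add: convex_on_def flip: distrib_right)
    thus ?thesis by (simp add: f_def secular_def[abs_def])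
  qed

  have "\<forall>\<^sub>F \<mu> in at_top. f \<mu> < 0"
    unfolding f_def
    by (rule order_tendstoD(2)[OF secular_tendsto_at_top]) (use lam_pos in auto)
  hence "\<forall>\<^sub>F \<mu> in at_top. f \<mu> < 0 \<and> \<mu>0 \<le> \<mu>"
    using eventually_ge_at_top by (rule eventually_conj)
  then obtain b where b: "f b < 0" "\<mu>0 \<le> b"
    using eventually_happens'[OF trivial_limit_at_top_linorder] by blast
  have "{\<mu>0..b} \<subseteq> S"
    using assms(5) by (auto simp: S_def secular_dom_def)
  hence "continuous_on {\<mu>0..b} f"
    using deriv by (intro continuous_at_imp_continuous_on) (auto intro: DERIV_isCont)
  then obtain \<mu>s where root: "\<mu>s \<in> {\<mu>0..b}" "f \<mu>s = 0"
    using IVT2'[of f b 0 \<mu>0] b assms(6) by (auto simp: f_def)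
  hence "\<mu>s \<in> S" using \<open>{\<mu>0..b} \<subseteq> S\<close> by blast
  have start: "\<mu>0 \<in> S" "f \<mu>0 \<ge> 0"
    using assms(5,6) by (auto simp: S_def f_def)
  have "newton_raphson_well_defined_on S f \<mu>0" "newton_raphson f \<mu>0 \<longlonglongrightarrow> \<mu>s"
    using newton_raphson_convex_decreasing[OF S(1) conv deriv neg \<open>\<mu>s \<in> S\<close> root(2) start]
    by blast+
  moreover have "\<forall>\<mu>\<in>S. f \<mu> = 0 \<longrightarrow> \<mu> = \<mu>s"
    using convex_decreasing_root_unique[OF S(1) conv deriv neg _ _ \<open>\<mu>s \<in> S\<close> root(2)] by blast
  ultimately show ?thesis
    using \<open>\<mu>s \<in> S\<close> root(2) unfolding S_def f_def by blast
qed

end
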